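(* Let $0<\varepsilon_2\le 2\varepsilon_1<3^{-3}$ be reals, let $x,y$ be sufficiently large integers (how large may depend on $\varepsilon_1,\varepsilon_2$), and let $RT(\varepsilon_2,x,y)$ be the Reuleaux construction. Then $$|\mathcal{A}_{\varepsilon_2}(RT(\varepsilon_2,x,y))|=3x^2+3xy,\qquad |\mathcal{N}_{\varepsilon_1}(RT(\varepsilon_2,x,y))|=\Theta\big(\varepsilon_1 y^2+x^2\big),$$ where the implied constants in $\Theta$ are absolute.
   Context: Reuleaux triangle: let $P_0,P_1,P_2\in\mathbb{R}^2$ form an equilateral triangle of side length $1$; for each $i$ (indices modulo $3$ throughout), draw the circular arc of radius $1$ centered at $P_{i+2}$ joining $P_i$ and $P_{i+1}$ (the shorter arc). The region bounded by the three arcs is the Reuleaux triangle with corners $P_0,P_1,P_2$; it has diameter $1$. Reuleaux construction $RT(\varepsilon,x,y)$, for $0<\varepsilon<1$ and positive integers $x,y$: for each $i\in\{0,1,2\}$ let $A_i,B_i,C_i,D_i$ be the points on the arc $P_{i+1}P_{i+2}$ with $|A_iP_{i+1}|=|B_iP_{i+2}|=1/3$ and $|C_iP_{i+1}|=|D_iP_{i+2}|=\varepsilon/2$ (Euclidean distances). For each $i\in\{0,1,2\}$ place $y$ equally spaced points along the sub-arc $A_iB_i$, and place $x$ (distinct, otherwise arbitrary) points inside the triangle $\mathcal{T}_i:=P_iC_{i-1}D_{i+1}$. The resulting set of $3x+3y$ points is $RT(\varepsilon,x,y)$. For a finite set $X\subset\mathbb{R}^2$ and $0<\eta<1$, $\mathcal{A}_\eta(X)$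 is the set of unordered pairs $\{u,v\}\subset X$ of distinct points with $\|u-v\|\ge 1-\eta$, and $\mathcal{N}_\eta(X)$ is the set of unordered pairs $\{u,v\}\subset X$ of distinct points with $\|u-v\|\le\eta$. $f=\Theta(g)$ means $cg\le f\le Cg$ for some absolute constants $0<c\le C$. *)

theory Defs
  imports "HOL-Library.Numeral_Type" "HOL-Complex_Analysis.Contour_Integration"
begin

(* The Euclidean plane is the type complex, where dist is the Euclidean distance.  Indices modulo 3
   are elements of the three-element ring type 3, so that i + 1, i + 2, i - 1 are taken modulo 3. *)

text \<open>
  The shorter circular arc about \<open>c\<close> from \<open>p\<close> to \<open>q\<close>, for \<open>p\<close> and \<open>q\<close> at the same distance from
  \<open>c\<close>, as a path on \<open>{0..1}\<close> of constant speed. It may run clockwise or anticlockwise: the signed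
  angle from \<open>p - c\<close> to \<open>q - c\<close> is \<open>Arg ((q - c) / (p - c))\<close>, which lies in \<open>]-pi, pi]\<close>.
\<close>

definition minor_arc :: "complex \<Rightarrow> complex \<Rightarrow> complex \<Rightarrow> real \<Rightarrow> complex" where
  "minor_arc c p q =
     part_circlepath c (dist c p) (Arg (p - c)) (Arg (p - c) + Arg ((q - c) / (p - c)))"

lemma minor_arc_eq: "minor_arc c p q t = c + (p - c) * cis (t * Arg ((q - c) / (p - c)))"
proof -
  have "complex_of_real (dist c p) * cis (Arg (p - c)) = p - c"
    by (metis dist_commute dist_norm rcis_cmod_Arg rcis_def)
  moreover have "minor_arc c p q t =
      c + complex_of_real (dist c p) * cis (Arg (p - c) + t * Arg ((q - c) / (p - c)))"
    unfolding minor_arc_def part_circlepath_def linepath_def cis_conv_exp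
    by (simp add: algebra_simps)
  ultimately show ?thesis
    by (simp add: mult.assoc [symmetric] flip: cis_mult)
qed

lemma minor_arc_0: "minor_arc c p q 0 = p"
  by (simp add: minor_arc_eq)

lemma minor_arc_1:
  assumes "dist c p = dist c q"
  shows "minor_arc c p q 1 = q"
proof (cases "p = c")
  case True
  with assms show ?thesis by (simp add: minor_arc_eq)
next
  case False
  then have "q \<noteq> c"
    using assms by auto
  with False assms have "cmod ((q - c) / (p - c)) = 1"
    by (simp add: norm_divide dist_norm norm_minus_commute)
  then have "cis (Arg ((q - c) / (p - c))) = (q - c) / (p - c)"
    by (metis mult_1 of_real_1 rcis_cmod_Arg rcis_def)
  with False show ?thesis by (simp add: minor_arc_eq)
qed

definition unit_equilateral :: "(3 \<Rightarrow> complex) \<Rightarrow> bool" where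
  "unit_equilateral P \<longleftrightarrow> (\<forall>i j. i \<noteq> j \<longrightarrow> dist (P i) (P j) = 1)"

text \<open>The side of the Reuleaux triangle opposite to the corner \<open>P i\<close>.\<close>

definition reuleaux_arc :: "(3 \<Rightarrow> complex) \<Rightarrow> 3 \<Rightarrow> complex set" where
  "reuleaux_arc P i = path_image (minor_arc (P i) (P (i + 1)) (P (i + 2)))"

text \<open>
  \<open>S\<close> consists of \<open>n\<close> equally spaced points along the constant-speed path \<open>g\<close>: consecutive
  parameters differ by the same \<open>d > 0\<close>, and the pieces of the path left over before the first and
  after the last point are no longer than the common spacing. This allows every usual convention
  about the end points (both included, one included, both excluded, centres of \<open>n\<close> equal pieces).
\<close>

definition equally_spaced :: "(real \<Rightarrow> complex) \<Rightarrow> nat \<Rightarrow> complex set \<Rightarrow> bool" where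
  "equally_spaced g n S \<longleftrightarrow>
     (\<exists>a d. 0 < d \<and> 0 \<le> a \<and> a \<le> d \<and> a + (real n - 1) * d \<le> 1 \<and> 1 - (a + (real n - 1) * d) \<le> d \<and>
        S = (\<lambda>k. g (a + real k * d)) ` {..<n})"

text \<open>
  The construction leaves choices open, so \<open>RT \<epsilon> x y\<close> is the set of all point sets that it can
  produce. The triangles containing the sets \<open>Q i\<close> are closed.
\<close>

definition RT :: "real \<Rightarrow> nat \<Rightarrow> nat \<Rightarrow> complex set set" where
  "RT \<epsilon> x y = {X. \<exists>P A B C D S Q.
     unit_equilateral P \<and>
     (\<forall>i. A i \<in> reuleaux_arc P i \<and> dist (A i) (P (i + 1)) = 1 / 3 \<and>
          B i \<in> reuleaux_arc P i \<and> dist (B i) (P (i + 2)) = 1 / 3 \<and>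
          C i \<in> reuleaux_arc P i \<and> dist (C i) (P (i + 1)) = \<epsilon> / 2 \<and>
          D i \<in> reuleaux_arc P i \<and> dist (D i) (P (i + 2)) = \<epsilon> / 2) \<and>
     (\<forall>i. equally_spaced (minor_arc (P i) (A i) (B i)) y (S i)) \<and>
     (\<forall>i. Q i \<subseteq> convex hull {P i, C (i - 1), D (i + 1)} \<and> finite (Q i) \<and> card (Q i) = x) \<and>
     X = (\<Union>i. S i \<union> Q i)}"

definition almost_diam_pairs :: "real \<Rightarrow> complex set \<Rightarrow> complex set set" where
  "almost_diam_pairs \<eta> X = {{u, v} | u v. u \<in> X \<and> v \<in> X \<and> u \<noteq> v \<and> 1 - \<eta> \<le> dist u v}"

definition near_pairs :: "real \<Rightarrow> complex set \<Rightarrow> complex set set" where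
  "near_pairs \<eta> X = {{u, v} | u v. u \<in> X \<and> v \<in> X \<and> u \<noteq> v \<and> dist u v \<le> \<eta>}"

end

theory Submission imports Defs begin

text \<open>
  Around each corner \<open>P i\<close> lies a cluster \<open>Q i\<close> of \<open>x\<close> points, all within \<open>\<epsilon>\<^sub>2 / 2\<close> of \<open>P i\<close>: the ball of
  that radius is convex and contains the vertices of the triangle. On the opposite side lies a cluster
  \<open>S i\<close> of \<open>y\<close> points, all at distance exactly \<open>1\<close> from \<open>P i\<close>. By the triangle inequality, points of
  two different corner clusters, or of a corner cluster and the opposite side cluster, are at distance
  at least \<open>1 - \<epsilon>\<^sub>2\<close>. These are \<open>3 x\<^sup>2 + 3 x y\<close> pairs, and the first count says that there
  are no others. The only pairs for which this is not immediate contain a point of a side cluster.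

  The geometric input is \<open>adjacent_sides_dist\<close>: for \<open>u\<close> and \<open>v\<close> on two sides that meet at a corner,
  with \<open>a\<close> and \<open>b\<close> the distances of \<open>u\<close> and \<open>v\<close> from the far ends of their sides, one has
  \<open>\<bar>u - v\<bar>\<^sup>2 \<le> 1 - a b\<close>. Since the side clusters keep distance \<open>1/3\<close> from the corners, two of
  their points on different sides are at distance at most \<open>\<surd>(8/9) < 26/27\<close>. Taking for \<open>v\<close> the common corner
  bounds the distance from a point of a side cluster to the ends of its side by \<open>\<surd>(2/3) < 17/18\<close>, and two
  points on the same side are no farther apart than the farther of them is from an end of it. As
  \<open>\<epsilon>\<^sub>2 < 1/27\<close>, both bounds stay below \<open>1 - \<epsilon>\<^sub>2\<close>, the second one even after moving
  the corner by \<open>\<epsilon>\<^sub>2 / 2\<close>.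

  The same bounds show that points of different clusters are more than \<open>1/54\<close> apart, so that near pairs
  live inside single clusters. In a side cluster the distance between the points number \<open>k\<close> and \<open>l\<close> is
  comparable to \<open>\<bar>k - l\<bar> / y\<close>, which makes the number of near pairs comparable to
  \<open>y \<sqdot> \<epsilon>\<^sub>1 y\<close> once \<open>y\<close> is large compared with \<open>1 / \<epsilon>\<^sub>1\<close>. A corner cluster has at most \<open>x\<^sup>2\<close> pairs;
  it lies in a disc of radius \<open>\<epsilon>\<^sub>2 / 2 \<le> \<epsilon>\<^sub>1\<close>, which boundedly many cells of diameter at most \<open>\<epsilon>\<^sub>1\<close>
  cover, so a positive proportion of its pairs is near by the pigeonhole principle.
\<close>

section \<open>Chords of the unit circle and arcs\<close>

lemma cmod_cis_diff: "cmod (cis a - cis b) = 2 * \<bar>sin ((a - b) / 2)\<bar>"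
proof -
  have "cis a - cis b = cis b * (cis (a - b) - 1)"
    by (simp add: algebra_simps cis_mult)
  then have "cmod (cis a - cis b) = cmod (cis (a - b) - 1)"
    by (simp add: norm_mult)
  then show ?thesis
    using dist_exp_i_1 [of "a - b"] by (simp add: cis_conv_exp)
qed

lemma cmod_cis_diff_le: "cmod (cis a - cis b) \<le> \<bar>a - b\<bar>"
  using abs_sin_x_le_abs_x [of "(a - b) / 2"] by (simp add: cmod_cis_diff)

text \<open>
  Chord and angle are comparable for angles up to \<open>2\<close>, because \<open>\<bar>sin x - x\<bar> \<le> \<bar>x\<bar>\<^sup>3 / 6 \<le> \<bar>x\<bar> / 2\<close>
  for \<open>\<bar>x\<bar> \<le> 1\<close>.
\<close>

lemma cmod_cis_diff_ge:
  assumes "\<bar>a - b\<bar> \<le> 2"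
  shows "\<bar>a - b\<bar> / 2 \<le> cmod (cis a - cis b)"
proof -
  define x where "x = (a - b) / 2"
  have x: "\<bar>x\<bar> \<le> 1"
    using assms by (simp add: x_def)
  have "\<bar>sin x - x\<bar> \<le> \<bar>x\<bar> ^ 3 / 6"
    using Maclaurin_sin_bound [of x 3]
    by (simp add: sin_coeff_def eval_nat_numeral)
  moreover have "\<bar>x\<bar> ^ 3 \<le> \<bar>x\<bar>"
    using x power_decreasing [of 1 3 "\<bar>x\<bar>"] by simp
  ultimately have "\<bar>x\<bar> / 2 \<le> \<bar>sin x\<bar>"
    by linarith
  then show ?thesis
    by (simp add: cmod_cis_diff x_def)
qed

text \<open>
  The sign \<open>\<sigma>\<close> is the orientation of the triangle. Carrying it along as a factor of all angles treats
  both orientations at once.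
\<close>

lemma equilateral_rotation:
  fixes p q r :: complex
  assumes "dist p q = 1" "dist q r = 1" "dist p r = 1"
  obtains \<sigma> :: real where "\<sigma> = 1 \<or> \<sigma> = - 1" "r = p + (q - p) * cis (\<sigma> * (pi / 3))"
proof -
  \<comment> \<open>Both \<open>z\<close> and \<open>z - 1\<close> have norm \<open>1\<close>, which forces \<open>Re z = 1/2\<close>.\<close>
  define z where "z = (r - p) / (q - p)"
  have "q \<noteq> p"
    using assms by auto
  then have r: "r = p + (q - p) * z"
    by (simp add: z_def)
  then have rq: "r - q = (q - p) * (z - 1)"
    by (simp add: algebra_simps)
  have "cmod (q - p) = 1" "cmod (r - p) = 1" "cmod (r - q) = 1"
    using assms by (simp_all add: dist_norm norm_minus_commute)
  then have "cmod z = 1" "cmod (z - 1) = 1"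
    using rq by (simp_all add: z_def norm_divide norm_mult)
  then have 1: "(Re z)\<^sup>2 + (Im z)\<^sup>2 = 1" and 2: "(Re z - 1)\<^sup>2 + (Im z)\<^sup>2 = 1"
    by (simp_all add: cmod_def)
  from 1 2 have re: "Re z = 1 / 2"
    by (simp add: power2_eq_square algebra_simps)
  with 1 have "(Im z)\<^sup>2 = (sqrt 3 / 2)\<^sup>2"
    by (simp add: power2_eq_square field_simps)
  then have "Im z = sqrt 3 / 2 \<or> Im z = - (sqrt 3 / 2)"
    by (simp only: power2_eq_iff)
  then have "z = cis (1 * (pi / 3)) \<or> z = cis (- 1 * (pi / 3))"
    using re by (auto simp: complex_eq_iff cos_60 sin_60)
  then show thesis
    using that [of 1] that [of "- 1"] r by auto
qed

lemma Arg_cis_quotient: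
  assumes "w \<noteq> 0" "\<bar>b - a\<bar> < pi"
  shows "Arg ((w * cis b) / (w * cis a)) = b - a"
proof -
  have "(w * cis b) / (w * cis a) = cis (b - a)"
    using assms by (simp add: cis_divide)
  moreover have "Arg (cis (b - a)) = b - a"
    using assms by (intro cis_Arg_unique) (auto simp: sgn_eq)
  ultimately show ?thesis by simp
qed

lemma minor_arc_cis:
  assumes "w \<noteq> 0" "\<bar>b - a\<bar> < pi"
  shows "minor_arc p (p + w * cis a) (p + w * cis b) t = p + w * cis (a + t * (b - a))"
proof -
  have "minor_arc p (p + w * cis a) (p + w * cis b) t = p + w * cis a * cis (t * (b - a))"
    unfolding minor_arc_eq by (simp only: add_diff_cancel_left' Arg_cis_quotient [OF assms])
  then show ?thesis
    by (simp add: mult.assoc cis_mult)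
qed

lemma minor_arc_radius:
  assumes "u \<in> path_image (minor_arc p q r)"
  shows "dist u p = dist p q"
proof -
  obtain t where "u = minor_arc p q r t"
    using assms by (auto simp: path_image_def)
  then have "u - p = (q - p) * cis (t * Arg ((r - p) / (q - p)))"
    by (simp add: minor_arc_eq)
  then have "cmod (u - p) = cmod (q - p)"
    by (simp add: norm_mult)
  then show ?thesis
    by (simp add: dist_norm norm_minus_commute)
qed


section \<open>Distances on the sides of a Reuleaux triangle\<close>

text \<open>
  For an equilateral triangle \<open>p\<close>, \<open>q\<close>, \<open>r\<close> of side length \<open>1\<close>, the side from \<open>q\<close> to \<open>r\<close> is parametrised
  by the angle seen from the opposite corner \<open>p\<close>, measured from \<open>q\<close>.
\<close>

lemma side_eq_angles:
  fixes \<sigma> :: real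
  assumes "dist p q = 1" and \<sigma>: "\<sigma> = 1 \<or> \<sigma> = - 1" and r: "r = p + (q - p) * cis (\<sigma> * (pi / 3))"
  shows "path_image (minor_arc p q r) = (\<lambda>s. p + (q - p) * cis (\<sigma> * s)) ` {0..pi / 3}"
proof -
  have "q - p \<noteq> 0"
    using assms by auto
  moreover have "\<bar>\<sigma> * (pi / 3) - 0\<bar> < pi"
    using \<sigma> by auto
  ultimately have "minor_arc p (p + (q - p) * cis 0) (p + (q - p) * cis (\<sigma> * (pi / 3))) t =
      p + (q - p) * cis (0 + t * (\<sigma> * (pi / 3) - 0))" for t
    by (rule minor_arc_cis)
  then have "minor_arc p q r = (\<lambda>s. p + (q - p) * cis (\<sigma> * s)) \<circ> (\<lambda>t. t * (pi / 3))"
    using r by (simp add: fun_eq_iff ac_simps)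
  moreover have "(\<lambda>t. t * (pi / 3)) ` {0..1} = {0..pi / 3}"
    using image_mult_atLeastAtMost [of "pi / 3" 0 1] by (simp add: mult.commute)
  ultimately show ?thesis
    unfolding path_image_def by (metis image_comp)
qed

text \<open>
  Let \<open>s\<close> be the angle at \<open>p\<close> between \<open>q\<close> and \<open>u\<close>, and \<open>t\<close> the angle at \<open>q\<close> between \<open>p\<close> and \<open>v\<close>; both
  are at most \<open>\<pi> / 3\<close>. Expanding gives the identity
  \<open>\<bar>u - v\<bar>\<^sup>2 = 1 - 8 sin (s/2) sin (t/2) cos ((s + t)/2)\<close>, in which \<open>2 sin (s/2)\<close> and \<open>2 sin (t/2)\<close> are
  the chords \<open>\<bar>u - q\<bar>\<close> and \<open>\<bar>v - p\<bar>\<close>, while the cosine is at least \<open>cos (\<pi>/3) = 1/2\<close>.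
\<close>

lemma adjacent_sides_dist:
  assumes tri: "dist p q = 1" "dist q r = 1" "dist p r = 1"
    and u: "u \<in> path_image (minor_arc p q r)" and v: "v \<in> path_image (minor_arc q r p)"
  shows "(dist u v)\<^sup>2 \<le> 1 - dist u q * dist v p"
proof -
  obtain \<sigma> :: real where \<sigma>: "\<sigma> = 1 \<or> \<sigma> = - 1" and r: "r = p + (q - p) * cis (\<sigma> * (pi / 3))"
    using equilateral_rotation [OF tri] .
  define w where "w = q - p"
  have w: "cmod w = 1"
    using tri by (simp add: w_def dist_norm norm_minus_commute)
  have rq: "r - q = w * cis (\<sigma> * (2 * pi / 3))"
    using \<sigma> unfolding r w_def
    by (auto simp: complex_eq_iff cos_60 sin_60 cos_120 sin_120' cos_120' algebra_simps)
  have p: "p = q + (r - q) * cis (\<sigma> * (pi / 3))"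
    using \<sigma> unfolding rq
    by (auto simp: w_def complex_eq_iff cos_60 sin_60 cos_120 sin_120' cos_120' algebra_simps)
  obtain s where s: "0 \<le> s" "s \<le> pi / 3" and us: "u = p + w * cis (\<sigma> * s)"
    using u side_eq_angles [OF tri(1) \<sigma> r] by (auto simp: w_def)
  obtain t' where t': "0 \<le> t'" "t' \<le> pi / 3" and vt: "v = q + (r - q) * cis (\<sigma> * t')"
    using v side_eq_angles [OF tri(2) \<sigma> p] by auto
  \<comment> \<open>The side from \<open>r\<close> to \<open>p\<close> is parametrised from \<open>r\<close>; measuring from \<open>p\<close> makes the situation symmetric.\<close>
  define t where "t = pi / 3 - t'"
  have t: "0 \<le> t" "t \<le> pi / 3"
    using t' by (auto simp: t_def)
  have "cis (\<sigma> * (2 * pi / 3)) * cis (\<sigma> * t') = - cis (- (\<sigma> * t))"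
    using \<sigma> unfolding t_def cis_mult
    by (auto simp: complex_eq_iff algebra_simps cos_diff sin_diff cos_add sin_add cos_60 sin_60 cos_120 sin_120' cos_120')
  then have v': "v = q - w * cis (- (\<sigma> * t))"
    unfolding vt rq by (simp add: mult.assoc)
  have uq: "dist u q = 2 * sin (s / 2)"
  proof -
    have "u - q = w * (cis (\<sigma> * s) - cis 0)"
      by (simp add: us w_def algebra_simps)
    then have "dist u q = 2 * \<bar>sin (\<sigma> * s / 2)\<bar>"
      using cmod_cis_diff [of "\<sigma> * s" 0] by (simp add: dist_norm norm_mult w)
    then show ?thesis
      using \<sigma> s sin_ge_zero [of "s / 2"] by auto
  qed
  have vp: "dist v p = 2 * sin (t / 2)"
  proof -
    have "v - p = w * (cis 0 - cis (- (\<sigma> * t)))"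
      by (simp add: v' w_def algebra_simps)
    then have "dist v p = 2 * \<bar>sin (\<sigma> * t / 2)\<bar>"
      using cmod_cis_diff [of 0 "- (\<sigma> * t)"] by (simp add: dist_norm norm_mult w)
    then show ?thesis
      using \<sigma> t sin_ge_zero [of "t / 2"] by auto
  qed
  have "u - v = w * (cis (\<sigma> * s) + cis (- (\<sigma> * t)) - 1)"
    by (simp add: us v' w_def algebra_simps)
  then have "dist u v = cmod (cis (\<sigma> * s) + cis (- (\<sigma> * t)) - 1)"
    by (simp only: dist_norm norm_mult w mult_1)
  then have "(dist u v)\<^sup>2 = (cos s + cos t - 1)\<^sup>2 + (sin s - sin t)\<^sup>2"
    using \<sigma> by (auto simp: cmod_power2 power2_commute)
  also have "\<dots> = 1 - 8 * sin (s / 2) * sin (t / 2) * cos ((s + t) / 2)"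
  proof -
    define S C S' C' where "S = sin (s / 2)" "C = cos (s / 2)" "S' = sin (t / 2)" "C' = cos (t / 2)"
    have *: "sin s = 2 * S * C" "sin t = 2 * S' * C'" "cos s = 1 - 2 * S\<^sup>2" "cos t = 1 - 2 * S'\<^sup>2"
      using sin_double [of "s / 2"] sin_double [of "t / 2"]
        cos_double_sin [of "s / 2"] cos_double_sin [of "t / 2"]
      by (auto simp: S_C_S'_C'_def)
    have "cos ((s + t) / 2) = C * C' - S * S'"
      by (simp add: S_C_S'_C'_def add_divide_distrib cos_add)
    moreover have "C\<^sup>2 = 1 - S\<^sup>2" "C'\<^sup>2 = 1 - S'\<^sup>2"
      by (simp_all add: S_C_S'_C'_def cos_squared_eq)
    ultimately show ?thesis
      unfolding * S_C_S'_C'_def(1,3) [symmetric] by algebra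
  qed
  also have "\<dots> \<le> 1 - dist u q * dist v p"
  proof -
    have "cos (pi / 3) \<le> cos ((s + t) / 2)"
      using s t by (intro cos_monotone_0_pi_le) auto
    then have "1 / 2 \<le> cos ((s + t) / 2)"
      by (simp add: cos_60)
    moreover have "0 \<le> dist u q * dist v p"
      by simp
    ultimately have "dist u q * dist v p * (1 / 2) \<le> dist u q * dist v p * cos ((s + t) / 2)"
      by (rule mult_left_mono)
    then show ?thesis
      by (simp add: uq vp)
  qed
  finally show ?thesis .
qed

lemma dist_on_unit_circle:
  assumes "cmod w = 1" and \<sigma>: "\<sigma> = 1 \<or> \<sigma> = - 1"
  shows "dist (p + w * cis (\<sigma> * a)) (p + w * cis (\<sigma> * b)) = 2 * \<bar>sin ((a - b) / 2)\<bar>"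
proof -
  have "p + w * cis (\<sigma> * a) - (p + w * cis (\<sigma> * b)) = w * (cis (\<sigma> * a) - cis (\<sigma> * b))"
    by (simp add: algebra_simps)
  then have "dist (p + w * cis (\<sigma> * a)) (p + w * cis (\<sigma> * b)) = cmod (cis (\<sigma> * a) - cis (\<sigma> * b))"
    using assms by (simp only: dist_norm norm_mult mult_1)
  also have "\<dots> = 2 * \<bar>sin (\<sigma> * ((a - b) / 2))\<bar>"
    by (simp add: cmod_cis_diff algebra_simps diff_divide_distrib)
  also have "\<bar>sin (\<sigma> * ((a - b) / 2))\<bar> = \<bar>sin ((a - b) / 2)\<bar>"
  proof -
    have "sin (- 1 * ((a - b) / 2)) = - sin ((a - b) / 2)"
      by (simp only: mult_minus1 sin_minus)
    then show ?thesis
      using \<sigma> by auto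
  qed
  finally show ?thesis .
qed

text \<open>
  On a single side the chord grows with the angle, and the angle between \<open>u\<close> and \<open>v\<close> is at most the larger
  of their angles from \<open>q\<close>.
\<close>

lemma side_dist_le_end:
  assumes tri: "dist p q = 1" "dist q r = 1" "dist p r = 1"
    and u: "u \<in> path_image (minor_arc p q r)" and v: "v \<in> path_image (minor_arc p q r)"
  shows "dist u v \<le> max (dist u q) (dist v q)"
proof -
  obtain \<sigma> :: real where \<sigma>: "\<sigma> = 1 \<or> \<sigma> = - 1" and r: "r = p + (q - p) * cis (\<sigma> * (pi / 3))"
    using equilateral_rotation [OF tri] .
  have w: "cmod (q - p) = 1"
    using tri by (simp add: dist_norm norm_minus_commute)
  obtain s where s: "0 \<le> s" "s \<le> pi / 3" and us: "u = p + (q - p) * cis (\<sigma> * s)"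
    using u side_eq_angles [OF tri(1) \<sigma> r] by auto
  obtain t where t: "0 \<le> t" "t \<le> pi / 3" and vt: "v = p + (q - p) * cis (\<sigma> * t)"
    using v side_eq_angles [OF tri(1) \<sigma> r] by auto
  have "dist u q = 2 * sin (s / 2)" "dist v q = 2 * sin (t / 2)"
    using dist_on_unit_circle [OF w \<sigma>, of p s 0] dist_on_unit_circle [OF w \<sigma>, of p t 0]
      s t sin_ge_zero [of "s / 2"] sin_ge_zero [of "t / 2"]
    by (simp_all add: us vt)
  moreover have "dist u v = 2 * \<bar>sin ((s - t) / 2)\<bar>"
    unfolding us vt by (rule dist_on_unit_circle [OF w \<sigma>])
  moreover have "\<bar>sin ((s - t) / 2)\<bar> = sin (\<bar>s - t\<bar> / 2)"
  proof (cases "t \<le> s")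
    case True
    then show ?thesis
      using s t sin_ge_zero [of "(s - t) / 2"] by auto
  next
    case False
    then show ?thesis
      using s t sin_ge_zero [of "(t - s) / 2"] sin_minus [of "(t - s) / 2"]
      by (simp add: minus_divide_left)
  qed
  moreover have "sin (\<bar>s - t\<bar> / 2) \<le> sin (max s t / 2)"
    using s t by (intro sin_monotone_2pi_le) auto
  ultimately show ?thesis
    by (auto simp: max_def split: if_splits)
qed

text \<open>
  A corner at which two sides meet lies on both of them, so this is the case of the bound for adjacent sides in which
  one of the two points is that corner; its distance to the far end of its side is \<open>1\<close>.
\<close>

lemma side_dist_corners:
  assumes tri: "dist p q = 1" "dist q r = 1" "dist p r = 1"
    and u: "u \<in> path_image (minor_arc p q r)"
  shows "(dist u r)\<^sup>2 \<le> 1 - dist u q" "(dist u q)\<^sup>2 \<le> 1 - dist u r"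
proof -
  have "minor_arc q r p 0 \<in> path_image (minor_arc q r p)"
    by (simp add: path_image_def)
  then have "r \<in> path_image (minor_arc q r p)"
    by (simp add: minor_arc_0)
  then show "(dist u r)\<^sup>2 \<le> 1 - dist u q"
    using adjacent_sides_dist [OF tri u, of r] tri by (simp add: dist_commute [of r p])
  have "minor_arc r p q 1 \<in> path_image (minor_arc r p q)"
    by (simp add: path_image_def)
  then have "q \<in> path_image (minor_arc r p q)"
    using tri by (simp add: minor_arc_1 dist_commute)
  then show "(dist u q)\<^sup>2 \<le> 1 - dist u r"
    using adjacent_sides_dist [of r p q q u] u tri by (simp add: dist_commute)
qed

text \<open>
  The points \<open>A\<close> and \<open>B\<close> cut off pieces of equal chord \<open>\<delta>\<close> at the two ends of the side. The condition
  \<open>\<delta> \<le> 1/2\<close> guarantees that they come in the order \<open>q\<close>, \<open>A\<close>, \<open>B\<close>, \<open>r\<close> along the side, so that the arc from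
  \<open>A\<close> to \<open>B\<close> is what is left of the side between them.
\<close>

lemma trimmed_side:
  assumes tri: "dist p q = 1" "dist q r = 1" "dist p r = 1"
    and A: "A \<in> path_image (minor_arc p q r)" "dist A q = \<delta>"
    and B: "B \<in> path_image (minor_arc p q r)" "dist B r = \<delta>"
    and \<delta>: "\<delta> \<le> 1 / 2"
  shows "path_image (minor_arc p A B) \<subseteq>
           {u \<in> path_image (minor_arc p q r). \<delta> \<le> dist u q \<and> \<delta> \<le> dist u r}"
    and "\<bar>Arg ((B - p) / (A - p))\<bar> \<le> pi / 3"
proof -
  obtain \<sigma> :: real where \<sigma>: "\<sigma> = 1 \<or> \<sigma> = - 1" and r: "r = p + (q - p) * cis (\<sigma> * (pi / 3))"
    using equilateral_rotation [OF tri] .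
  define w where "w = q - p"
  have w: "cmod w = 1" "w \<noteq> 0"
    using tri by (auto simp: w_def dist_norm norm_minus_commute)
  note side = side_eq_angles [OF tri(1) \<sigma> r, folded w_def]
  obtain a where a: "0 \<le> a" "a \<le> pi / 3" and Aa: "A = p + w * cis (\<sigma> * a)"
    using A side by auto
  obtain b where b: "0 \<le> b" "b \<le> pi / 3" and Bb: "B = p + w * cis (\<sigma> * b)"
    using B side by auto
  have q_dist: "dist (p + w * cis (\<sigma> * c)) q = 2 * sin (c / 2)" if "0 \<le> c" "c \<le> pi / 3" for c
    using dist_on_unit_circle [OF w(1) \<sigma>, of p c 0] sin_ge_zero [of "c / 2"] that
    by (simp add: w_def)
  have r_dist: "dist (p + w * cis (\<sigma> * c)) r = 2 * sin ((pi / 3 - c) / 2)" if "0 \<le> c" "c \<le> pi / 3" for c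
    using dist_on_unit_circle [OF w(1) \<sigma>, of p "pi / 3" c] sin_ge_zero [of "(pi / 3 - c) / 2"] that
    by (simp add: r w_def dist_commute)
  \<comment> \<open>Otherwise \<open>\<bar>B - q\<bar> < \<delta>\<close> and \<open>\<bar>B - r\<bar> = \<delta>\<close>, too close for \<open>\<bar>q - r\<bar> = 1\<close>.\<close>
  have "a \<le> b"
  proof (rule ccontr)
    assume "\<not> a \<le> b"
    then have "sin (b / 2) < sin (a / 2)"
      using a b by (intro sin_monotone_2pi) auto
    then have "dist B q < dist A q"
      using q_dist [OF a] q_dist [OF b] by (simp add: Aa Bb)
    moreover have "1 \<le> dist B q + dist B r"
      using dist_triangle [of q r B] tri by (simp add: dist_commute)
    ultimately show False
      using A B \<delta> by simp
  qed
  have "\<bar>\<sigma> * b - \<sigma> * a\<bar> = b - a"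
    using \<sigma> \<open>a \<le> b\<close> by auto
  then have ab: "\<bar>\<sigma> * b - \<sigma> * a\<bar> \<le> pi / 3"
    using a b by simp
  then have ab': "\<bar>\<sigma> * b - \<sigma> * a\<bar> < pi"
    using pi_gt_zero by linarith
  have "Arg ((B - p) / (A - p)) = \<sigma> * b - \<sigma> * a"
    using Arg_cis_quotient [OF w(2) ab'] by (simp add: Aa Bb)
  then show "\<bar>Arg ((B - p) / (A - p))\<bar> \<le> pi / 3"
    using ab by simp
  show "path_image (minor_arc p A B) \<subseteq>
           {u \<in> path_image (minor_arc p q r). \<delta> \<le> dist u q \<and> \<delta> \<le> dist u r}"
  proof
    fix u
    assume "u \<in> path_image (minor_arc p A B)"
    then obtain t where t: "0 \<le> t" "t \<le> 1" and u: "u = minor_arc p A B t"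
      by (auto simp: path_image_def)
    define c where "c = a + t * (b - a)"
    have uc: "u = p + w * cis (\<sigma> * c)"
      unfolding u Aa Bb minor_arc_cis [OF w(2) ab'] by (simp add: c_def algebra_simps)
    have "0 \<le> t * (b - a)" "t * (b - a) \<le> b - a"
      using t \<open>a \<le> b\<close> mult_right_mono [of t 1 "b - a"] by auto
    then have c: "a \<le> c" "c \<le> b" "0 \<le> c" "c \<le> pi / 3"
      using a b by (auto simp: c_def)
    have "sin (a / 2) \<le> sin (c / 2)"
      using a c by (intro sin_monotone_2pi_le) auto
    then have "\<delta> \<le> dist u q"
      using A q_dist [OF a] q_dist [OF c(3,4)] by (simp add: Aa uc)
    moreover have "sin ((pi / 3 - b) / 2) \<le> sin ((pi / 3 - c) / 2)"
      using b c by (intro sin_monotone_2pi_le) auto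
    then have "\<delta> \<le> dist u r"
      using B r_dist [OF b] r_dist [OF c(3,4)] by (simp add: Bb uc)
    moreover have "u \<in> path_image (minor_arc p q r)"
      using c unfolding side uc by auto
    ultimately show "u \<in> {u \<in> path_image (minor_arc p q r). \<delta> \<le> dist u q \<and> \<delta> \<le> dist u r}"
      by simp
  qed
qed

section \<open>Equally spaced points along an arc\<close>

lemma equally_spaced_subset:
  assumes "equally_spaced g n S"
  shows "S \<subseteq> path_image g"
proof -
  obtain a d where d: "0 < d" "0 \<le> a" "a + (real n - 1) * d \<le> 1"
    and S: "S = (\<lambda>k. g (a + real k * d)) ` {..<n}"
    using assms by (auto simp: equally_spaced_def)
  have "a + real k * d \<in> {0..1}" if "k < n" for k
  proof -
    have "real k * d \<le> (real n - 1) * d"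
      using that d by (intro mult_right_mono) auto
    then have "a + real k * d \<le> 1"
      using d by linarith
    then show ?thesis
      using d by simp
  qed
  then show ?thesis
    by (auto simp: S path_image_def)
qed

text \<open>
  The spacing \<open>d\<close> lies between \<open>1 / (2 n)\<close> and \<open>2 / n\<close>, whatever happens at the end points, and the total angle \<open>\<phi>\<close>
  of the arc lies between \<open>1/3\<close> and \<open>2\<close>: an angle is at least its chord. Points number \<open>k\<close> and \<open>l\<close> are
  separated by the angle \<open>\<bar>k - l\<bar> d \<bar>\<phi>\<bar>\<close>, and the chord lies between half the angle and the angle.
\<close>

lemma equally_spaced_arc_indexing:
  assumes spaced: "equally_spaced (minor_arc p A B) n S" and n: "2 \<le> n"
    and radius: "dist p A = 1" "dist p B = 1" and chord: "1 / 3 \<le> dist A B"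
    and angle: "\<bar>Arg ((B - p) / (A - p))\<bar> \<le> 2"
  obtains h :: "nat \<Rightarrow> complex" where "S = h ` {..<n}" 
    "\<And>k l. k < n \<Longrightarrow> l < n \<Longrightarrow> \<bar>real k - real l\<bar> / (12 * real n) \<le> dist (h k) (h l)"
    "\<And>k l. dist (h k) (h l) \<le> 4 * \<bar>real k - real l\<bar> / real n"
proof -
  define \<phi> where "\<phi> = Arg ((B - p) / (A - p))"
  have arc: "minor_arc p A B t = p + (A - p) * cis (t * \<phi>)" for t
    by (simp add: minor_arc_eq \<phi>_def)
  have w: "cmod (A - p) = 1"
    using radius by (simp add: dist_norm norm_minus_commute)
  have dist_arc: "dist (minor_arc p A B s) (minor_arc p A B t) = cmod (cis (s * \<phi>) - cis (t * \<phi>))" for s t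
  proof -
    have "minor_arc p A B s - minor_arc p A B t = (A - p) * (cis (s * \<phi>) - cis (t * \<phi>))"
      by (simp add: arc algebra_simps)
    then show ?thesis
      by (simp only: dist_norm norm_mult w mult_1)
  qed
  have "dist A B \<le> \<bar>\<phi>\<bar>"
    using dist_arc [of 0 1] cmod_cis_diff_le [of "0 * \<phi>" "1 * \<phi>"] radius
    by (simp add: minor_arc_0 minor_arc_1)
  then have \<phi>: "1 / 3 \<le> \<bar>\<phi>\<bar>" "\<bar>\<phi>\<bar> \<le> 2"
    using chord angle by (auto simp: \<phi>_def)
  obtain a d where d: "0 < d" and a: "0 \<le> a" "a \<le> d"
    and last: "a + (real n - 1) * d \<le> 1" "1 - (a + (real n - 1) * d) \<le> d"
    and S: "S = (\<lambda>k. minor_arc p A B (a + real k * d)) ` {..<n}"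
    using spaced by (auto simp: equally_spaced_def)
  have d_le: "d \<le> 2 / real n"
  proof -
    have "real n / 2 * d \<le> (real n - 1) * d"
      using n d by (intro mult_right_mono) auto
    then show ?thesis
      using last a n by (simp add: field_simps)
  qed
  have d_ge: "1 / (2 * real n) \<le> d"
  proof -
    have "1 \<le> (real n + 1) * d"
      using last a by (simp add: algebra_simps)
    also have "\<dots> \<le> (2 * real n) * d"
      using n d by (intro mult_right_mono) auto
    finally show ?thesis
      using n by (simp add: field_simps)
  qed
  define h where "h k = minor_arc p A B (a + real k * d)" for k
  have angle_diff: "\<bar>(a + real k * d) * \<phi> - (a + real l * d) * \<phi>\<bar> = \<bar>real k - real l\<bar> * d * \<bar>\<phi>\<bar>" for k l
  proof -
    have "(a + real k * d) * \<phi> - (a + real l * d) * \<phi> = (real k - real l) * d * \<phi>"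
      by (simp add: algebra_simps)
    then show ?thesis
      using d by (simp add: abs_mult)
  qed
  show thesis
  proof (rule that)
    show "S = h ` {..<n}"
      by (simp add: S h_def)
  next
    fix k l
    have "dist (h k) (h l) \<le> \<bar>real k - real l\<bar> * (d * \<bar>\<phi>\<bar>)"
      unfolding h_def dist_arc
      using cmod_cis_diff_le [of "(a + real k * d) * \<phi>" "(a + real l * d) * \<phi>"]
      by (simp only: angle_diff mult.assoc)
    also have "\<dots> \<le> \<bar>real k - real l\<bar> * (2 / real n * 2)"
      using d d_le \<phi> by (intro mult_left_mono mult_mono) auto
    finally show "dist (h k) (h l) \<le> 4 * \<bar>real k - real l\<bar> / real n"
      by (simp add: mult.commute)
  next
    fix k l
    assume kl: "k < n" "l < n"
    have "\<bar>real k - real l\<bar> \<le> real n - 1"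
      using kl by linarith
    then have "\<bar>real k - real l\<bar> * d \<le> (real n - 1) * d"
      using d by (intro mult_right_mono) auto
    then have "\<bar>real k - real l\<bar> * d \<le> 1"
      using last a by linarith
    then have "\<bar>real k - real l\<bar> * d * \<bar>\<phi>\<bar> \<le> 1 * 2"
      using \<phi> by (intro mult_mono) auto
    then have *: "\<bar>real k - real l\<bar> * (d * \<bar>\<phi>\<bar>) / 2 \<le> dist (h k) (h l)"
      unfolding h_def dist_arc
      using cmod_cis_diff_ge [of "(a + real k * d) * \<phi>" "(a + real l * d) * \<phi>"]
      by (simp only: angle_diff mult.assoc)
    have "\<bar>real k - real l\<bar> * (1 / (2 * real n) * (1 / 3)) \<le> \<bar>real k - real l\<bar> * (d * \<bar>\<phi>\<bar>)"
      using d d_ge \<phi> by (intro mult_left_mono mult_mono) auto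
    then show "\<bar>real k - real l\<bar> / (12 * real n) \<le> dist (h k) (h l)"
      using * by (simp add: field_simps)
  qed
qed

section \<open>Counting near pairs\<close>

lemma near_pairs_subset_doubletons: "near_pairs \<eta> X \<subseteq> (\<lambda>(u, v). {u, v}) ` (X \<times> X)"
  unfolding near_pairs_def by force

lemma finite_near_pairs: "finite X \<Longrightarrow> finite (near_pairs \<eta> X)"
  by (rule finite_subset [OF near_pairs_subset_doubletons]) simp

lemma card_near_pairs_le: "finite X \<Longrightarrow> card (near_pairs \<eta> X) \<le> (card X)\<^sup>2"
  using surj_card_le [OF _ near_pairs_subset_doubletons, of X \<eta>]
  by (simp add: card_cartesian_product power2_eq_square)

lemma near_pairs_mono: "X \<subseteq> Y \<Longrightarrow> near_pairs \<eta> X \<subseteq> near_pairs \<eta> Y"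
  by (auto simp: near_pairs_def)

text \<open>
  A near pair is determined by its smaller index and by the gap to its larger index, which is at most \<open>b \<eta>\<close>.
\<close>

lemma card_near_pairs_sequence_le:
  fixes h :: "nat \<Rightarrow> complex"
  assumes "\<And>k l. k < n \<Longrightarrow> l < n \<Longrightarrow> \<bar>real k - real l\<bar> / b \<le> dist (h k) (h l)"
    and "0 < b" "0 \<le> \<eta>"
  shows "real (card (near_pairs \<eta> (h ` {..<n}))) \<le> real n * (b * \<eta>)"
proof -
  define M where "M = nat \<lfloor>b * \<eta>\<rfloor>"
  have "near_pairs \<eta> (h ` {..<n}) \<subseteq> (\<lambda>(k, l). {h k, h l}) ` (SIGMA k:{..<n}. {k<..k + M})"
  proof
    fix e
    assume "e \<in> near_pairs \<eta> (h ` {..<n})"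
    then obtain k l where "k < n" "l < n" "h k \<noteq> h l" "dist (h k) (h l) \<le> \<eta>" "e = {h k, h l}"
      by (auto simp: near_pairs_def)
    then obtain k l where kl: "k < n" "l < n" "k < l" "dist (h k) (h l) \<le> \<eta>" "e = {h k, h l}"
      by (metis dist_commute insert_commute nat_neq_iff)
    then have "(real l - real k) / b \<le> \<eta>"
      using assms(1) [of k l] by simp
    then have "real l - real k \<le> b * \<eta>"
      using \<open>0 < b\<close> by (simp add: field_simps)
    then have "real (l - k) \<le> b * \<eta>"
      using kl by simp
    then have "l - k \<le> M"
      unfolding M_def by (simp add: le_nat_floor)
    then have "(k, l) \<in> (SIGMA k:{..<n}. {k<..k + M})"
      using kl by auto
    then show "e \<in> (\<lambda>(k, l). {h k, h l}) ` (SIGMA k:{..<n}. {k<..k + M})"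
      using kl by (intro image_eqI [where x = "(k, l)"]) auto
  qed
  then have "card (near_pairs \<eta> (h ` {..<n})) \<le> card (SIGMA k:{..<n}. {k<..k + M})"
    by (intro surj_card_le) auto
  also have "\<dots> = n * M"
    by simp
  finally have "real (card (near_pairs \<eta> (h ` {..<n}))) \<le> real n * real M"
    by (metis of_nat_le_iff of_nat_mult)
  also have "\<dots> \<le> real n * (b * \<eta>)"
    using assms by (intro mult_left_mono) (auto simp: M_def)
  finally show ?thesis .
qed

text \<open>
  Every pair of indices with a gap of at most \<open>m = \<lfloor>\<eta> / a\<rfloor>\<close> is near, and each of the first \<open>n - m\<close> indices is the
  smaller one of \<open>m\<close> such pairs. The condition \<open>2 a \<le> \<eta>\<close> makes the rounding harmless, and
  \<open>2 \<eta> \<le> a n\<close> keeps \<open>m \<le> n / 2\<close>.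
\<close>

lemma card_near_pairs_sequence_ge:
  fixes h :: "nat \<Rightarrow> complex"
  assumes "\<And>k l. dist (h k) (h l) \<le> a * \<bar>real k - real l\<bar>" and inj: "inj_on h {..<n}"
    and a: "0 < a" and \<eta>: "2 * a \<le> \<eta>" "2 * \<eta> \<le> a * real n"
  shows "real n * \<eta> / (4 * a) \<le> real (card (near_pairs \<eta> (h ` {..<n})))"
proof -
  define m where "m = nat \<lfloor>\<eta> / a\<rfloor>"
  have "2 \<le> \<eta> / a" "\<eta> / a \<le> real n / 2"
    using a \<eta> by (simp_all add: field_simps)
  then have m: "real m \<le> \<eta> / a" "\<eta> / (2 * a) \<le> real m" "real m \<le> real n / 2"
    unfolding m_def by linarith+
  define I where "I = (SIGMA k:{..<n - m}. {k<..k + m})"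
  have I: "k < n \<and> l < n \<and> k < l \<and> l \<le> k + m" if "(k, l) \<in> I" for k l
    using that m by (auto simp: I_def)
  have sub: "(\<lambda>(k, l). {h k, h l}) ` I \<subseteq> near_pairs \<eta> (h ` {..<n})"
  proof (clarify)
    fix k l
    assume "(k, l) \<in> I"
    note kl = I [OF this]
    have "dist (h k) (h l) \<le> a * real m"
    proof -
      have "\<bar>real k - real l\<bar> \<le> real m"
        using kl by linarith
      then have "a * \<bar>real k - real l\<bar> \<le> a * real m"
        using a by (intro mult_left_mono) auto
      then show ?thesis
        using assms(1) [of k l] by linarith
    qed
    then have "dist (h k) (h l) \<le> \<eta>"
      using m(1) a by (simp add: field_simps)
    moreover have "h k \<noteq> h l"
      using inj kl by (auto dest: inj_onD)
    ultimately show "{h k, h l} \<in> near_pairs \<eta> (h ` {..<n})"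
      using kl by (auto simp: near_pairs_def)
  qed
  have "inj_on (\<lambda>(k, l). {h k, h l}) I"
  proof (rule inj_onI, clarify)
    fix k l k' l'
    assume kl: "(k, l) \<in> I" "(k', l') \<in> I" and "{h k, h l} = {h k', h l'}"
    then have "(k = k' \<and> l = l') \<or> (k = l' \<and> l = k')"
      using I [OF kl(1)] I [OF kl(2)] inj by (auto simp: doubleton_eq_iff dest: inj_onD)
    then show "k = k' \<and> l = l'"
      using I [OF kl(1)] I [OF kl(2)] by auto
  qed
  then have "card I \<le> card (near_pairs \<eta> (h ` {..<n}))"
    using sub by (metis card_image card_mono finite_imageI finite_lessThan finite_near_pairs)
  moreover have "card I = (n - m) * m"
    by (simp add: I_def)
  moreover have "real n / 2 * (\<eta> / (2 * a)) \<le> real (n - m) * real m"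
    using m \<eta> a by (intro mult_mono) (auto simp: of_nat_diff)
  ultimately have "real n / 2 * (\<eta> / (2 * a)) \<le> real (card (near_pairs \<eta> (h ` {..<n})))"
    by (metis of_nat_le_iff of_nat_mult order_trans)
  then show ?thesis
    by simp
qed

text \<open>
  Cut the plane into square cells of side \<open>\<eta> / 2\<close>. The disc meets at most \<open>25\<close> of them, so some
  cell contains at least \<open>card Q / 25\<close> points, and any two points of one cell form a near pair. The bound on
  \<open>card Q\<close> ensures that this cell contains at least two points.
\<close>

lemma card_near_pairs_disc_ge:
  assumes Q: "finite Q" "Q \<subseteq> cball p \<eta>" and \<eta>: "0 < \<eta>" and large: "50 \<le> card Q"
  shows "(real (card Q))\<^sup>2 / 2500 \<le> real (card (near_pairs \<eta> Q))"
proof -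
  define f where "f z = (\<lfloor>2 * (Re z - Re p) / \<eta>\<rfloor>, \<lfloor>2 * (Im z - Im p) / \<eta>\<rfloor>)" for z
  have cell: "\<lfloor>2 * t / \<eta>\<rfloor> \<in> {-2..2}" if "\<bar>t\<bar> \<le> \<eta>" for t
  proof -
    have "- 2 \<le> 2 * t / \<eta>" "2 * t / \<eta> \<le> 2"
      using that \<eta> by (auto simp: field_simps)
    then show ?thesis
      by (simp add: le_floor_iff)
  qed
  have "f z \<in> {-2..2} \<times> {-2..2}" if "z \<in> Q" for z
  proof -
    have "cmod (z - p) \<le> \<eta>"
      using that Q by (auto simp: dist_norm norm_minus_commute)
    then have "\<bar>Re z - Re p\<bar> \<le> \<eta>" "\<bar>Im z - Im p\<bar> \<le> \<eta>"
      using abs_Re_le_cmod [of "z - p"] abs_Im_le_cmod [of "z - p"] by auto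
    then show ?thesis
      unfolding f_def using cell by blast
  qed
  then have "f \<in> Q \<rightarrow> {-2..2} \<times> {-2..2}"
    by auto
  from pigeonhole_card [OF this Q(1)] obtain c
    where c: "card Q \<le> card (f -` {c} \<inter> Q) * 25"
    by (auto simp: card_cartesian_product)
  define G where "G = f -` {c} \<inter> Q"
  define n where "n = card G"
  have same_cell: "\<bar>s - t\<bar> \<le> \<eta> / 2" if "\<lfloor>2 * s / \<eta>\<rfloor> = \<lfloor>2 * t / \<eta>\<rfloor>" for s t
  proof -
    have "\<bar>2 * s / \<eta> - 2 * t / \<eta>\<bar> \<le> 1"
      using that by linarith
    then have "\<bar>2 * (s - t) / \<eta>\<bar> \<le> 1"
      by (simp add: right_diff_distrib diff_divide_distrib)
    then have "\<bar>2 * (s - t)\<bar> \<le> \<eta>"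
      using \<eta> by (simp add: abs_divide)
    then have "2 * \<bar>s - t\<bar> \<le> \<eta>"
      by (simp only: abs_mult abs_numeral)
    then show ?thesis
      by simp
  qed
  have "dist u v \<le> \<eta>" if "u \<in> G" "v \<in> G" for u v
  proof -
    have "f u = f v"
      using that by (auto simp: G_def)
    then have "\<lfloor>2 * (Re u - Re p) / \<eta>\<rfloor> = \<lfloor>2 * (Re v - Re p) / \<eta>\<rfloor>"
      "\<lfloor>2 * (Im u - Im p) / \<eta>\<rfloor> = \<lfloor>2 * (Im v - Im p) / \<eta>\<rfloor>"
      by (simp_all only: f_def prod.inject)
    from this [THEN same_cell] show ?thesis
      using cmod_le [of "u - v"] by (simp add: dist_norm)
  qed
  then have "{u, v} \<in> near_pairs \<eta> Q" if "u \<in> G" "v \<in> G" "u \<noteq> v" for u v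
    using that unfolding near_pairs_def G_def by blast
  then have "{e. e \<subseteq> G \<and> card e = 2} \<subseteq> near_pairs \<eta> Q"
    by (auto simp: card_2_iff)
  then have "card {e. e \<subseteq> G \<and> card e = 2} \<le> card (near_pairs \<eta> Q)"
    using Q by (intro card_mono finite_near_pairs)
  then have "n choose 2 \<le> card (near_pairs \<eta> Q)"
    using n_subsets [of G 2] Q by (simp only: n_def G_def finite_Int simp_thms)
  moreover have "real (n choose 2) = real n * (real n - 1) / 2"
  proof (induction n)
    case (Suc n)
    have "Suc n choose 2 = n + (n choose 2)"
      by (simp add: numeral_2_eq_2)
    then have "real (Suc n choose 2) = real n + real (n choose 2)"
      by (simp only: of_nat_add)
    then show ?case
      unfolding Suc.IH by (simp add: field_simps)
  qed simp
  moreover have n: "real (card Q) / 25 \<le> real n" "2 \<le> real n"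
  proof -
    have "card Q \<le> n * 25"
      using c by (simp only: n_def G_def)
    then show "real (card Q) / 25 \<le> real n" "2 \<le> real n"
      using large by linarith+
  qed
  have "(real (card Q) / 25)\<^sup>2 \<le> (real n)\<^sup>2"
    using n by (intro power_mono) auto
  moreover have "2 * real n \<le> real n * real n"
    using n by (intro mult_right_mono) auto
  ultimately show ?thesis
    by (simp add: power2_eq_square field_simps)
qed

section \<open>Clusters at the corners and along the sides\<close>

lemma cyclic_order_3:
  fixes i j :: 3
  shows "i \<noteq> j \<Longrightarrow> j = i + 1 \<or> i = j + 1"
    and "i + 1 \<noteq> i" "i + 1 + 1 \<noteq> i" "i + 1 + 2 = i" "i + 2 \<noteq> i" "i + 1 \<noteq> i + 2"
    and "i \<noteq> j \<Longrightarrow> j = i + 1 \<or> j = i + 2"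
proof -
  show "i \<noteq> j \<Longrightarrow> j = i + 1 \<or> i = j + 1" "i \<noteq> j \<Longrightarrow> j = i + 1 \<or> j = i + 2"
    using exhaust_3 [of i] exhaust_3 [of j] by auto
qed (simp_all add: add.assoc)

text \<open>
  These are the metric properties of the construction on which both counts rest. The constants leave room
  on both sides: \<open>17/18 + \<epsilon> / 2\<close> stays below \<open>1 - \<epsilon>\<close>, and \<open>1 - 17/18\<close> and \<open>1/3 - \<epsilon> / 2\<close> stay above \<open>1/54\<close>, the bound for the near distance.
\<close>

locale corner_and_side_clusters =
  fixes P :: "3 \<Rightarrow> complex" and Q S :: "3 \<Rightarrow> complex set" and \<epsilon> :: real
  assumes small: "0 < \<epsilon>" "\<epsilon> < 1 / 27"
    and corners: "i \<noteq> j \<Longrightarrow> dist (P i) (P j) = 1"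
    and finite_clusters: "finite (Q i)" "finite (S i)"
    and corner_radius: "u \<in> Q i \<Longrightarrow> dist u (P i) \<le> \<epsilon> / 2"
    and side_radius: "u \<in> S i \<Longrightarrow> dist u (P i) = 1"
    and side_far: "u \<in> S i \<Longrightarrow> j \<noteq> i \<Longrightarrow> 1 / 3 \<le> dist u (P j) \<and> dist u (P j) < 17 / 18"
    and side_side: "u \<in> S i \<Longrightarrow> v \<in> S j \<Longrightarrow> dist u v < 26 / 27"
begin

lemma corner_corner_far:
  assumes "u \<in> Q i" "v \<in> Q j" "i \<noteq> j"
  shows "1 - \<epsilon> \<le> dist u v"
  using corner_radius [OF assms(1)] corner_radius [OF assms(2)] corners [OF assms(3)]
    dist_triangle [of "P i" "P j" u] dist_triangle [of u "P j" v]
  by (simp add: dist_commute)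

lemma corner_same_near:
  assumes "u \<in> Q i" "v \<in> Q i"
  shows "dist u v \<le> \<epsilon>"
  using corner_radius [OF assms(1)] corner_radius [OF assms(2)] dist_triangle2 [of u v "P i"]
  by simp

lemma corner_opposite_side_far:
  assumes "u \<in> Q i" "v \<in> S i"
  shows "1 - \<epsilon> \<le> dist u v"
  using corner_radius [OF assms(1)] side_radius [OF assms(2)] dist_triangle [of v "P i" u] small
  by (simp add: dist_commute)

lemma corner_adjacent_side:
  assumes "u \<in> Q i" "v \<in> S j" "i \<noteq> j"
  shows "1 / 54 < dist u v" "dist u v < 1 - \<epsilon>"
  using corner_radius [OF assms(1)] side_far [OF assms(2,3)] small
    dist_triangle [of v "P i" u] dist_triangle [of u v "P i"]
  by (simp_all add: dist_commute)

lemma side_side_apart: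
  assumes "u \<in> S i" "v \<in> S j" "i \<noteq> j"
  shows "1 / 54 < dist u v"
  using side_radius [OF assms(1)] side_far [OF assms(2,3)] dist_triangle [of u "P i" v]
  by simp

lemma clusters_disjoint:
  "i \<noteq> j \<Longrightarrow> Q i \<inter> Q j = {}" "i \<noteq> j \<Longrightarrow> S i \<inter> S j = {}" "Q i \<inter> S j = {}"
proof -
  show "Q i \<inter> Q j = {}" if "i \<noteq> j"
  proof (rule ccontr)
    assume "Q i \<inter> Q j \<noteq> {}"
    then obtain u where "u \<in> Q i" "u \<in> Q j"
      by auto
    then show False
      using corner_corner_far [of u i u j] that small by simp
  qed
  show "S i \<inter> S j = {}" if "i \<noteq> j"
  proof (rule ccontr)
    assume "S i \<inter> S j \<noteq> {}"
    then obtain u where "u \<in> S i" "u \<in> S j"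
      by auto
    then show False
      using side_side_apart [of u i u j] that by simp
  qed
  show "Q i \<inter> S j = {}"
  proof (rule ccontr)
    assume "Q i \<inter> S j \<noteq> {}"
    then obtain u where "u \<in> Q i" "u \<in> S j"
      by auto
    then show False
      using corner_opposite_side_far [of u i u] corner_adjacent_side [of u i u j] small
      by (cases "i = j") auto
  qed
qed

text \<open>
  Only the next corner cluster is listed, not the previous one, so that every almost-diametral pair of
  corner points arises exactly once.
\<close>

definition far_partners :: "3 \<Rightarrow> complex set" where
  "far_partners i = Q (i + 1) \<union> S i"

lemma almost_diam_pairs_eq:
  "almost_diam_pairs \<epsilon> (\<Union>i. S i \<union> Q i) = (\<lambda>(u, v). {u, v}) ` (\<Union>i. Q i \<times> far_partners i)"
proof (intro subset_antisym subsetI)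
  fix e
  assume "e \<in> almost_diam_pairs \<epsilon> (\<Union>i. S i \<union> Q i)"
  then obtain u v i j where e: "e = {u, v}" and uv: "u \<in> S i \<union> Q i" "v \<in> S j \<union> Q j"
    and far: "1 - \<epsilon> \<le> dist u v"
    by (auto simp: almost_diam_pairs_def)
  have "(u \<in> Q i \<and> v \<in> Q j \<and> i \<noteq> j) \<or> (u \<in> Q i \<and> v \<in> S i) \<or> (v \<in> Q j \<and> u \<in> S j)"
    using uv far small corner_same_near [of u i v] corner_adjacent_side [of u i v j]
      corner_adjacent_side [of v j u i] side_side [of u i v j]
    by (cases "i = j") (auto simp: dist_commute)
  then have "(u \<in> Q i \<and> v \<in> Q (i + 1)) \<or> (v \<in> Q j \<and> u \<in> Q (j + 1)) \<or>
      (u \<in> Q i \<and> v \<in> S i) \<or> (v \<in> Q j \<and> u \<in> S j)"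
    using cyclic_order_3(1) [of i j] by auto
  then have "(u, v) \<in> (\<Union>i. Q i \<times> far_partners i) \<or> (v, u) \<in> (\<Union>i. Q i \<times> far_partners i)"
    by (auto simp: far_partners_def)
  then show "e \<in> (\<lambda>(u, v). {u, v}) ` (\<Union>i. Q i \<times> far_partners i)"
    unfolding e by (metis (mono_tags, lifting) case_prod_conv imageI insert_commute)
next
  fix e
  assume "e \<in> (\<lambda>(u, v). {u, v}) ` (\<Union>i. Q i \<times> far_partners i)"
  then obtain u v i where e: "e = {u, v}" and u: "u \<in> Q i" and v: "v \<in> Q (i + 1) \<or> v \<in> S i"
    by (auto simp: far_partners_def)
  then have far: "1 - \<epsilon> \<le> dist u v"
    using corner_corner_far [of u i v "i + 1"] corner_opposite_side_far [of u i v]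
      cyclic_order_3(2) [of i] by auto
  then have "u \<noteq> v"
    using small by auto
  then show "e \<in> almost_diam_pairs \<epsilon> (\<Union>i. S i \<union> Q i)"
    using e u v far by (auto simp: almost_diam_pairs_def)
qed

text \<open>
  The ordered pairs \<open>(u, v)\<close> with \<open>u\<close> in a corner cluster and \<open>v\<close> one of its far partners give pairwise different
  unordered pairs: if \<open>(v, u)\<close> were of this form as well, then each of two corners would be the successor of the other,
  which is impossible in a cycle of length \<open>3\<close>.
\<close>

lemma card_almost_diam_pairs:
  assumes "\<And>i. card (Q i) = x" "\<And>i. card (S i) = y"
  shows "card (almost_diam_pairs \<epsilon> (\<Union>i. S i \<union> Q i)) = 3 * x\<^sup>2 + 3 * x * y"
proof -
  have corner_eq: "i = j" if "u \<in> Q i" "u \<in> Q j" for u i j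
    using clusters_disjoint(1) [of i j] that by auto
  have "inj_on (\<lambda>(u, v). {u, v}) (\<Union>i. Q i \<times> far_partners i)"
  proof (rule inj_onI, clarify)
    fix u v u' v' i j
    assume u: "u \<in> Q i" "u' \<in> Q j" and v: "v \<in> far_partners i" "v' \<in> far_partners j"
      and eq: "{u, v} = {u', v'}"
    show "u = u' \<and> v = v'"
    proof (rule ccontr)
      assume "\<not> (u = u' \<and> v = v')"
      then have "u = v'" "v = u'"
        using eq by (auto simp: doubleton_eq_iff)
      then have "u \<in> Q (j + 1)" "v \<in> Q (i + 1)" "v \<in> Q j"
        using u v clusters_disjoint(3) [of i j] clusters_disjoint(3) [of j i]
        by (auto simp: far_partners_def)
      then have "i = j + 1" "j = i + 1"
        using corner_eq u by auto
      then show False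
        using cyclic_order_3(3) [of i] by simp
    qed
  qed
  then have "card (almost_diam_pairs \<epsilon> (\<Union>i. S i \<union> Q i)) = card (\<Union>i. Q i \<times> far_partners i)"
    by (simp add: almost_diam_pairs_eq card_image)
  also have "\<dots> = (\<Sum>i\<in>UNIV. card (Q i \<times> far_partners i))"
  proof (rule card_UN_disjoint)
    show "\<forall>i\<in>UNIV. finite (Q i \<times> far_partners i)"
      using finite_clusters by (simp add: far_partners_def)
    show "\<forall>i\<in>UNIV. \<forall>j\<in>UNIV. i \<noteq> j \<longrightarrow> Q i \<times> far_partners i \<inter> Q j \<times> far_partners j = {}"
      using clusters_disjoint(1) by (auto simp: Times_Int_Times)
  qed simp
  also have "\<dots> = (\<Sum>i\<in>(UNIV :: 3 set). x * (x + y))"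
  proof (rule sum.cong)
    fix i
    have "card (far_partners i) = x + y"
      unfolding far_partners_def using assms finite_clusters clusters_disjoint(3)
      by (simp add: card_Un_disjoint)
    then show "card (Q i \<times> far_partners i) = x * (x + y)"
      using assms by (simp add: card_cartesian_product)
  qed simp
  also have "\<dots> = 3 * x\<^sup>2 + 3 * x * y"
    by (simp add: power2_eq_square algebra_simps)
  finally show ?thesis .
qed

lemma near_pairs_within_clusters:
  assumes "\<eta> \<le> 1 / 54"
  shows "near_pairs \<eta> (\<Union>i. S i \<union> Q i) \<subseteq> (\<Union>i. near_pairs \<eta> (S i) \<union> near_pairs \<eta> (Q i))"
proof
  fix e
  assume "e \<in> near_pairs \<eta> (\<Union>i. S i \<union> Q i)"
  then obtain u v i j where e: "e = {u, v}" "u \<noteq> v" and uv: "u \<in> S i \<union> Q i" "v \<in> S j \<union> Q j"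
    and near: "dist u v \<le> \<eta>"
    by (auto simp: near_pairs_def)
  have "(u \<in> Q i \<and> v \<in> Q i) \<or> (u \<in> S i \<and> v \<in> S i)"
    using uv near assms small corner_corner_far [of u i v j] corner_adjacent_side(1) [of u i v j]
      corner_adjacent_side(1) [of v j u i] side_side_apart [of u i v j]
      corner_opposite_side_far [of u i v] corner_opposite_side_far [of v i u]
    by (cases "i = j") (auto simp: dist_commute)
  then have "e \<in> near_pairs \<eta> (S i) \<union> near_pairs \<eta> (Q i)"
    using e near by (auto simp: near_pairs_def)
  then show "e \<in> (\<Union>i. near_pairs \<eta> (S i) \<union> near_pairs \<eta> (Q i))"
    by auto
qed

lemma card_near_pairs_within_clusters:
  assumes "\<eta> \<le> 1 / 54"
  shows "card (near_pairs \<eta> (\<Union>i. S i \<union> Q i))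
      \<le> (\<Sum>i\<in>UNIV. card (near_pairs \<eta> (S i)) + card (near_pairs \<eta> (Q i)))"
proof -
  have "card (near_pairs \<eta> (\<Union>i. S i \<union> Q i))
      \<le> card (\<Union>i. near_pairs \<eta> (S i) \<union> near_pairs \<eta> (Q i))"
    using near_pairs_within_clusters [OF assms] finite_clusters
    by (intro card_mono) (auto intro: finite_near_pairs)
  also have "\<dots> \<le> (\<Sum>i\<in>UNIV. card (near_pairs \<eta> (S i) \<union> near_pairs \<eta> (Q i)))"
    by (rule card_UN_le) simp
  also have "\<dots> \<le> (\<Sum>i\<in>UNIV. card (near_pairs \<eta> (S i)) + card (near_pairs \<eta> (Q i)))"
    by (intro sum_mono card_Un_le)
  finally show ?thesis .
qed

end

section \<open>The Reuleaux construction\<close>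

text \<open>
  The corners \<open>P i\<close>, \<open>P (i + 1)\<close>, \<open>P (i + 2)\<close> play the roles of \<open>p\<close>, \<open>q\<close>, \<open>r\<close>. Their cyclic shift
  describes the next side, which is how the bound for adjacent sides applies to \<open>S i\<close> and \<open>S (i + 1)\<close>.
\<close>

lemma RT_clusters:
  assumes X: "X \<in> RT \<epsilon> x y" and \<epsilon>: "0 < \<epsilon>" "\<epsilon> < 1 / 27" and y: "2 \<le> y"
  obtains P Q S and h :: "3 \<Rightarrow> nat \<Rightarrow> complex"
  where "corner_and_side_clusters P Q S \<epsilon>" "X = (\<Union>i. S i \<union> Q i)"
    "\<And>i. card (Q i) = x" "\<And>i. S i = h i ` {..<y}"
    "\<And>i k l. k < y \<Longrightarrow> l < y \<Longrightarrow> \<bar>real k - real l\<bar> / (12 * real y) \<le> dist (h i k) (h i l)"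
    "\<And>i k l. dist (h i k) (h i l) \<le> 4 * \<bar>real k - real l\<bar> / real y"
proof -
  obtain P A B C D S Q where P: "unit_equilateral P"
    and "\<forall>i. A i \<in> reuleaux_arc P i \<and> dist (A i) (P (i + 1)) = 1 / 3 \<and>
          B i \<in> reuleaux_arc P i \<and> dist (B i) (P (i + 2)) = 1 / 3 \<and>
          C i \<in> reuleaux_arc P i \<and> dist (C i) (P (i + 1)) = \<epsilon> / 2 \<and>
          D i \<in> reuleaux_arc P i \<and> dist (D i) (P (i + 2)) = \<epsilon> / 2"
    and spaced: "\<forall>i. equally_spaced (minor_arc (P i) (A i) (B i)) y (S i)"
    and Q: "\<forall>i. Q i \<subseteq> convex hull {P i, C (i - 1), D (i + 1)} \<and> finite (Q i) \<and> card (Q i) = x"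
    and X_eq: "X = (\<Union>i. S i \<union> Q i)"
    using X by (auto simp: RT_def)
  then have A: "A i \<in> path_image (minor_arc (P i) (P (i + 1)) (P (i + 2)))" "dist (A i) (P (i + 1)) = 1 / 3"
    and B: "B i \<in> path_image (minor_arc (P i) (P (i + 1)) (P (i + 2)))" "dist (B i) (P (i + 2)) = 1 / 3"
    and C: "dist (C i) (P (i + 1)) = \<epsilon> / 2" and D: "dist (D i) (P (i + 2)) = \<epsilon> / 2" for i
    by (auto simp: reuleaux_arc_def)
  have corner: "dist (P i) (P j) = 1" if "i \<noteq> j" for i j
    using P that by (simp add: unit_equilateral_def)
  have tri: "dist (P i) (P (i + 1)) = 1" "dist (P (i + 1)) (P (i + 2)) = 1" "dist (P i) (P (i + 2)) = 1" for i
    using cyclic_order_3(2,5,6) [of i] by (auto intro!: corner)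
  note trimmed = trimmed_side [OF tri A B, simplified]
  have S: "u \<in> path_image (minor_arc (P i) (P (i + 1)) (P (i + 2)))"
      "1 / 3 \<le> dist u (P (i + 1))" "1 / 3 \<le> dist u (P (i + 2))" if "u \<in> S i" for u i
    using equally_spaced_subset [of "minor_arc (P i) (A i) (B i)" y "S i"] spaced trimmed(1) [of i] that
    by auto
  have S_far: "dist u (P (i + 1)) < 17 / 18" "dist u (P (i + 2)) < 17 / 18" if "u \<in> S i" for u i
  proof -
    have "(dist u (P (i + 1)))\<^sup>2 < (17 / 18)\<^sup>2" "(dist u (P (i + 2)))\<^sup>2 < (17 / 18)\<^sup>2"
      using side_dist_corners [OF tri S(1) [OF that]] S(2,3) [OF that]
      by (simp_all add: power_divide)
    then show "dist u (P (i + 1)) < 17 / 18" "dist u (P (i + 2)) < 17 / 18"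
      using power2_less_imp_less [of "dist u (P (i + 1))" "17 / 18"]
        power2_less_imp_less [of "dist u (P (i + 2))" "17 / 18"] by simp_all
  qed
  have same_side: "dist u v < 26 / 27" if "u \<in> S i" "v \<in> S i" for u v i
    using side_dist_le_end [OF tri S(1) [OF that(1)] S(1) [OF that(2)]]
      S_far(1) [OF that(1)] S_far(1) [OF that(2)] by simp
  have next_side: "dist u v < 26 / 27" if u: "u \<in> S i" and v: "v \<in> S (i + 1)" for u v i
  proof -
    have i: "i + 1 + 1 = i + 2" "i + 1 + 2 = i"
      using cyclic_order_3(4) [of i] by (simp_all add: add.assoc)
    have "(dist u v)\<^sup>2 \<le> 1 - dist u (P (i + 1)) * dist v (P i)"
      using adjacent_sides_dist [OF tri S(1) [OF u]] S(1) [OF v] by (simp only: i)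
    moreover have "1 / 3 * (1 / 3) \<le> dist u (P (i + 1)) * dist v (P i)"
      using S(2) [OF u] S(3) [OF v, unfolded i] by (intro mult_mono) auto
    ultimately have "(dist u v)\<^sup>2 < (26 / 27)\<^sup>2"
      by (simp add: power_divide)
    then show ?thesis
      by (rule power2_less_imp_less) simp
  qed
  have clusters: "corner_and_side_clusters P Q S \<epsilon>"
  proof
    fix i j u v
    show "0 < \<epsilon>" "\<epsilon> < 1 / 27"
      by (fact \<epsilon>)+
    show "dist (P i) (P j) = 1" if "i \<noteq> j"
      using that by (rule corner)
    show "finite (Q i)" "finite (S i)"
      using Q spaced [rule_format, of i] by (auto simp: equally_spaced_def)
    show "dist u (P i) \<le> \<epsilon> / 2" if "u \<in> Q i"
    proof -
      have "convex hull {P i, C (i - 1), D (i + 1)} \<subseteq> cball (P i) (\<epsilon> / 2)"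
      proof (rule hull_minimal)
        have "dist (C (i - 1)) (P i) = \<epsilon> / 2" "dist (D (i + 1)) (P i) = \<epsilon> / 2"
          using C [of "i - 1"] D [of "i + 1"] cyclic_order_3(4) [of i] by simp_all
        then show "{P i, C (i - 1), D (i + 1)} \<subseteq> cball (P i) (\<epsilon> / 2)"
          using \<epsilon> by (simp add: dist_commute [of "P i"])
      qed simp
      then have "u \<in> cball (P i) (\<epsilon> / 2)"
        using Q that by blast
      then show ?thesis
        by (simp add: dist_commute)
    qed
    show "dist u (P i) = 1" if "u \<in> S i"
      using minor_arc_radius [OF S(1) [OF that]] tri(1) [of i] by simp
    show "1 / 3 \<le> dist u (P j) \<and> dist u (P j) < 17 / 18" if "u \<in> S i" "j \<noteq> i"
      using S(2,3) [OF that(1)] S_far [OF that(1)] cyclic_order_3(7) [of i j] that(2) by auto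
    show "dist u v < 26 / 27" if "u \<in> S i" "v \<in> S j"
      using same_side [of u i v] next_side [of u i v] next_side [of v j u] cyclic_order_3(1) [of i j] that
      by (cases "i = j") (auto simp: dist_commute)
  qed
  have "\<exists>h. S i = h ` {..<y} \<and>
      (\<forall>k l. k < y \<longrightarrow> l < y \<longrightarrow> \<bar>real k - real l\<bar> / (12 * real y) \<le> dist (h k) (h l)) \<and>
      (\<forall>k l. dist (h k) (h l) \<le> 4 * \<bar>real k - real l\<bar> / real y)" for i
  proof -
    have AB: "dist (P i) (A i) = 1" "dist (P i) (B i) = 1"
      using minor_arc_radius [OF A(1) [of i]] minor_arc_radius [OF B(1) [of i]] tri(1) [of i]
      by (simp_all add: dist_commute)
    have chord: "1 / 3 \<le> dist (A i) (B i)"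
      using dist_triangle [of "P (i + 1)" "P (i + 2)" "A i"] dist_triangle [of "A i" "P (i + 2)" "B i"]
        tri(2) [of i] A(2) [of i] B(2) [of i] by (simp add: dist_commute)
    have "\<bar>Arg ((B i - P i) / (A i - P i))\<bar> \<le> 2"
      using trimmed(2) [of i] pi_less_4 by linarith
    then show ?thesis
      by (rule equally_spaced_arc_indexing [OF spaced [rule_format, of i] y AB chord]) blast
  qed
  then obtain h where "\<forall>i. S i = h i ` {..<y} \<and>
      (\<forall>k l. k < y \<longrightarrow> l < y \<longrightarrow> \<bar>real k - real l\<bar> / (12 * real y) \<le> dist (h i k) (h i l)) \<and>
      (\<forall>k l. dist (h i k) (h i l) \<le> 4 * \<bar>real k - real l\<bar> / real y)"
    by metis
  then have h: "S i = h i ` {..<y}"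
    "k < y \<Longrightarrow> l < y \<Longrightarrow> \<bar>real k - real l\<bar> / (12 * real y) \<le> dist (h i k) (h i l)"
    "dist (h i k) (h i l) \<le> 4 * \<bar>real k - real l\<bar> / real y" for i k l
    by blast+
  have "card (Q i) = x" for i
    using Q by blast
  from that [OF clusters X_eq this h] show thesis .
qed

text \<open>
  The three side clusters contribute at most \<open>12 \<epsilon>\<^sub>1 y\<^sup>2\<close> near pairs each and the three corner clusters at most
  \<open>x\<^sup>2\<close> each, hence the factor \<open>36\<close>. From below, a single side cluster gives \<open>\<epsilon>\<^sub>1 y\<^sup>2 / 16\<close> and a single
  corner cluster gives \<open>x\<^sup>2 / 2500\<close>; half of each bound together gives the factor \<open>1 / 5000\<close>.
\<close>

lemma RT_pair_counts:
  assumes X: "X \<in> RT \<epsilon>2 x y" and \<epsilon>2: "0 < \<epsilon>2" "\<epsilon>2 \<le> 2 * \<epsilon>1" and \<epsilon>1: "\<epsilon>1 < 1 / 54"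
    and x: "50 \<le> x" and y: "8 / \<epsilon>1 \<le> real y"
  shows "card (almost_diam_pairs \<epsilon>2 X) = 3 * x\<^sup>2 + 3 * x * y"
    and "1 / 5000 * (\<epsilon>1 * (real y)\<^sup>2 + (real x)\<^sup>2) \<le> real (card (near_pairs \<epsilon>1 X))"
    and "real (card (near_pairs \<epsilon>1 X)) \<le> 36 * (\<epsilon>1 * (real y)\<^sup>2 + (real x)\<^sup>2)"
proof -
  have \<epsilon>: "0 < \<epsilon>1" "\<epsilon>2 < 1 / 27" "\<epsilon>2 / 2 \<le> \<epsilon>1"
    using \<epsilon>2 \<epsilon>1 by auto
  have y8: "8 \<le> real y * \<epsilon>1"
    using y \<epsilon> by (simp add: field_simps)
  have "real y * \<epsilon>1 \<le> real y * 1"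
    using \<epsilon>1 by (intro mult_left_mono) auto
  then have y2: "2 \<le> y" "0 < real y"
    using y8 by linarith+
  obtain P Q S h where "corner_and_side_clusters P Q S \<epsilon>2" and X_eq: "X = (\<Union>i. S i \<union> Q i)"
    and Q: "\<And>i. card (Q i) = x" and S: "\<And>i. S i = h i ` {..<y}"
    and lower: "\<And>i k l. k < y \<Longrightarrow> l < y \<Longrightarrow> \<bar>real k - real l\<bar> / (12 * real y) \<le> dist (h i k) (h i l)"
    and upper: "\<And>i k l. dist (h i k) (h i l) \<le> 4 * \<bar>real k - real l\<bar> / real y"
    by (rule RT_clusters [OF X \<epsilon>2(1) \<epsilon>(2) y2(1)]) blast
  then interpret corner_and_side_clusters P Q S \<epsilon>2
    by simp
  have inj: "inj_on (h i) {..<y}" for i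
  proof (rule inj_onI)
    fix k l
    assume "k \<in> {..<y}" "l \<in> {..<y}" "h i k = h i l"
    then have "\<bar>real k - real l\<bar> / (12 * real y) \<le> 0"
      using lower [of k l i] by simp
    then show "k = l"
      using y2(2) by (simp add: divide_le_0_iff)
  qed
  show "card (almost_diam_pairs \<epsilon>2 X) = 3 * x\<^sup>2 + 3 * x * y"
    unfolding X_eq using Q by (rule card_almost_diam_pairs) (simp add: S card_image inj)
  have "real (card (near_pairs \<epsilon>1 X))
      \<le> real (\<Sum>i\<in>UNIV. card (near_pairs \<epsilon>1 (S i)) + card (near_pairs \<epsilon>1 (Q i)))"
    unfolding X_eq using card_near_pairs_within_clusters [of \<epsilon>1] \<epsilon>1 by (intro of_nat_mono) simp
  also have "\<dots> = (\<Sum>i\<in>UNIV. real (card (near_pairs \<epsilon>1 (S i))) + real (card (near_pairs \<epsilon>1 (Q i))))"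
    by simp
  also have "\<dots> \<le> (\<Sum>i\<in>(UNIV :: 3 set). real y * (12 * real y * \<epsilon>1) + (real x)\<^sup>2)"
  proof (intro sum_mono add_mono)
    fix i
    show "real (card (near_pairs \<epsilon>1 (S i))) \<le> real y * (12 * real y * \<epsilon>1)"
      unfolding S using lower y2 \<epsilon> by (intro card_near_pairs_sequence_le) auto
    show "real (card (near_pairs \<epsilon>1 (Q i))) \<le> (real x)\<^sup>2"
      using card_near_pairs_le [OF finite_clusters(1), of \<epsilon>1 i] Q
      by (metis of_nat_le_iff of_nat_power)
  qed
  also have "\<dots> \<le> 36 * (\<epsilon>1 * (real y)\<^sup>2 + (real x)\<^sup>2)"
    by (simp add: power2_eq_square algebra_simps)
  finally show "real (card (near_pairs \<epsilon>1 X)) \<le> 36 * (\<epsilon>1 * (real y)\<^sup>2 + (real x)\<^sup>2)" .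
  have finite_X: "finite X"
    using finite_clusters by (simp add: X_eq)
  have mono: "card (near_pairs \<epsilon>1 Y) \<le> card (near_pairs \<epsilon>1 X)" if "Y \<subseteq> X" for Y
    using finite_X that by (intro card_mono finite_near_pairs near_pairs_mono)
  have "real y * \<epsilon>1 / (4 * (4 / real y)) \<le> real (card (near_pairs \<epsilon>1 (h 0 ` {..<y})))"
    using upper inj y8 y2 \<epsilon>1 by (intro card_near_pairs_sequence_ge) (auto simp: field_simps)
  also have "\<dots> \<le> real (card (near_pairs \<epsilon>1 X))"
    using mono [of "h 0 ` {..<y}"] S by (auto simp: X_eq)
  finally have sides: "\<epsilon>1 * (real y)\<^sup>2 / 16 \<le> real (card (near_pairs \<epsilon>1 X))"
    by (simp add: power2_eq_square ac_simps)
  have "Q 0 \<subseteq> cball (P 0) \<epsilon>1"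
    using corner_radius [of _ 0] \<epsilon>(3) by (force simp: dist_commute)
  then have "(real (card (Q 0)))\<^sup>2 / 2500 \<le> real (card (near_pairs \<epsilon>1 (Q 0)))"
    using finite_clusters \<epsilon> x Q by (intro card_near_pairs_disc_ge) auto
  also have "\<dots> \<le> real (card (near_pairs \<epsilon>1 X))"
    using mono [of "Q 0"] by (auto simp: X_eq)
  finally have "(real x)\<^sup>2 / 2500 \<le> real (card (near_pairs \<epsilon>1 X))"
    by (simp add: Q)
  moreover have "0 \<le> \<epsilon>1 * (real y)\<^sup>2"
    using \<epsilon> by simp
  ultimately show "1 / 5000 * (\<epsilon>1 * (real y)\<^sup>2 + (real x)\<^sup>2) \<le> real (card (near_pairs \<epsilon>1 X))"
    using sides by (simp add: algebra_simps)
qed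

theorem proposition5p4:
  "\<exists>c C :: real. 0 < c \<and> c \<le> C \<and>
     (\<forall>\<epsilon>1 \<epsilon>2 :: real. 0 < \<epsilon>2 \<and> \<epsilon>2 \<le> 2 * \<epsilon>1 \<and> 2 * \<epsilon>1 < 1 / 3 ^ 3 \<longrightarrow>
       (\<exists>N :: nat. \<forall>x \<ge> N. \<forall>y \<ge> N. \<forall>X \<in> RT \<epsilon>2 x y.
          card (almost_diam_pairs \<epsilon>2 X) = 3 * x\<^sup>2 + 3 * x * y \<and>
          c * (\<epsilon>1 * (real y)\<^sup>2 + (real x)\<^sup>2) \<le> real (card (near_pairs \<epsilon>1 X)) \<and>
          real (card (near_pairs \<epsilon>1 X)) \<le> C * (\<epsilon>1 * (real y)\<^sup>2 + (real x)\<^sup>2)))"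
proof (intro exI conjI allI impI ballI)
  show "(0 :: real) < 1 / 5000" "(1 / 5000 :: real) \<le> 36"
    by simp_all
  fix \<epsilon>1 \<epsilon>2 :: real and x y X
  assume \<epsilon>: "0 < \<epsilon>2 \<and> \<epsilon>2 \<le> 2 * \<epsilon>1 \<and> 2 * \<epsilon>1 < 1 / 3 ^ 3"
  assume large: "max 50 (nat \<lceil>8 / \<epsilon>1\<rceil>) \<le> x" "max 50 (nat \<lceil>8 / \<epsilon>1\<rceil>) \<le> y"
  assume "X \<in> RT \<epsilon>2 x y"
  moreover have "8 / \<epsilon>1 \<le> real y" "50 \<le> x"
    using large by linarith+
  ultimately show "card (almost_diam_pairs \<epsilon>2 X) = 3 * x\<^sup>2 + 3 * x * y"
    "1 / 5000 * (\<epsilon>1 * (real y)\<^sup>2 + (real x)\<^sup>2) \<le> real (card (near_pairs \<epsilon>1 X))"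
    "real (card (near_pairs \<epsilon>1 X)) \<le> 36 * (\<epsilon>1 * (real y)\<^sup>2 + (real x)\<^sup>2)"
    using RT_pair_counts [of X \<epsilon>2 x y \<epsilon>1] \<epsilon> by simp_all
qed

end
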